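(* Let $h\in\mathbb R\setminus\{0\}$. For every $x\in\mathbb C\setminus\{-1/h\}$, the function $y\mapsto e_h(x,y)$ on $\mathbb R$ is an eigenfunction of the operator $\Delta_{y,h}$ with eigenvalue $x$, i.e. it is not identically zero and $$\Delta_{y,h}\,e_h(x,y)=x\,e_h(x,y)\qquad\text{for all } y\in\mathbb R.$$ For every $x\in\mathbb C\setminus\{1/h\}$, the function $y\mapsto e_{-h}(x,y)$ on $\mathbb R$ is an eigenfunction of the operator $\nabla_{y,h}$ with eigenvalue $x$, i.e. it is not identically zero and $$\nabla_{y,h}\,e_{-h}(x,y)=x\,e_{-h}(x,y)\qquad\text{for all } y\in\mathbb R.$$
   Context: For $h\in\mathbb R\setminus\{0\}$, the deformed exponential function is $e_h(x,y)=(1+hx)^{y/h}$ for $x\in\mathbb C\setminus\{-1/h\}$, $y\in\mathbb R$. Replacing $h$ by $-h$ gives $e_{-h}(x,y)=(1-hx)^{-y/h}$ for $x\in\mathbb C\setminus\{1/h\}$. Complex powers are taken with the principal branch, $w^{\alpha}=\exp(\alpha\operatorname{Log} w)$ for $w\neq 0$. The $h$-difference operators acting on a function of the variable $y$ are $$\Delta_{y,h} f(y)=\frac{f(y+h)-f(y)}{h},\qquad \nabla_{y,h} f(y)=\frac{f(y)-f(y-h)}{h}.$$ *)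

theory Defs
  imports "HOL-Analysis.Analysis"
begin

(* On complex, powr is exp (a * Ln w) with the principal logarithm for w \<noteq> 0.  For w = 0 it is
   totalised to 0, so the definition below is meaningful only for h \<noteq> 0 and x \<noteq> -1/h. *)
definition deformed_exp :: "real \<Rightarrow> complex \<Rightarrow> real \<Rightarrow> complex" where
  "deformed_exp h x y = (1 + of_real h * x) powr of_real (y / h)"

lemma deformed_exp_uminus:
  "deformed_exp (- h) x y = (1 - of_real h * x) powr of_real (- y / h)"
  by (simp add: deformed_exp_def)

definition forward_diff :: "real \<Rightarrow> (real \<Rightarrow> complex) \<Rightarrow> real \<Rightarrow> complex" where
  "forward_diff h f y = (f (y + h) - f y) / of_real h"

definition backward_diff :: "real \<Rightarrow> (real \<Rightarrow> complex) \<Rightarrow> real \<Rightarrow> complex" where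
  "backward_diff h f y = (f y - f (y - h)) / of_real h"

definition is_eigenfunction ::
  "((real \<Rightarrow> complex) \<Rightarrow> real \<Rightarrow> complex) \<Rightarrow> complex \<Rightarrow> (real \<Rightarrow> complex) \<Rightarrow> bool" where
  "is_eigenfunction T c f \<longleftrightarrow> (\<exists>y. f y \<noteq> 0) \<and> (\<forall>y. T f y = c * f y)"

end

theory Submission
  imports Defs
begin

text \<open>
  Increasing \<open>y\<close> by \<open>h\<close> raises the exponent \<open>y / h\<close> by exactly one, so the shift multiplies
  \<open>(1 + h x) powr (y / h)\<close> by its base \<open>1 + h x\<close>. Subtracting the unshifted value leaves the factor
  \<open>h x\<close>, and dividing by \<open>h\<close> leaves \<open>x\<close>. Only \<open>w powr (a + 1) = w * w powr a\<close> is involved, with the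
  same logarithm of the same base on both sides, so the branch cut does no harm.

  The backward statement is the forward one at step \<open>-h\<close>, because the backward difference with
  step \<open>h\<close> is the forward difference with step \<open>-h\<close>.
\<close>

lemma deformed_exp_shift:
  assumes "h \<noteq> 0" and "1 + of_real h * x \<noteq> 0"
  shows "deformed_exp h x (y + h) = (1 + of_real h * x) * deformed_exp h x y"
proof -
  have "complex_of_real ((y + h) / h) = of_real (y / h) + 1"
    using assms(1) by (simp add: field_simps)
  then show ?thesis
    using assms(2) by (simp only: deformed_exp_def powr_add) simp
qed

lemma deformed_exp_eigenfunction:
  assumes h: "h \<noteq> 0" and x: "x \<noteq> - 1 / of_real h"
  shows "is_eigenfunction (forward_diff h) x (deformed_exp h x)"
proof -
  have base: "1 + of_real h * x \<noteq> 0"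
  proof
    assume "1 + of_real h * x = 0"
    then have "of_real h * x = - 1"
      by (simp add: add_eq_0_iff)
    then have "x = - 1 / of_real h"
      using h by (metis nonzero_mult_div_cancel_left of_real_eq_0_iff)
    with x show False ..
  qed
  have "deformed_exp h x 0 \<noteq> 0"
    using base by (simp add: deformed_exp_def)
  moreover have "forward_diff h (deformed_exp h x) y = x * deformed_exp h x y" for y
    unfolding forward_diff_def deformed_exp_shift[OF h base] using h by (simp add: field_simps)
  ultimately show ?thesis
    unfolding is_eigenfunction_def by blast
qed

lemma backward_diff_eq_forward_diff_uminus: "backward_diff h = forward_diff (- h)"
  by (intro ext) (simp add: backward_diff_def forward_diff_def minus_divide_left)

theorem theorem4p2:
  fixes h :: real
  assumes "h \<noteq> 0"
  shows "(\<forall>x::complex. x \<noteq> - 1 / of_real h \<longrightarrow>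
            is_eigenfunction (forward_diff h) x (\<lambda>y. deformed_exp h x y)) \<and>
         (\<forall>x::complex. x \<noteq> 1 / of_real h \<longrightarrow>
            is_eigenfunction (backward_diff h) x (\<lambda>y. deformed_exp (- h) x y))"
  using assms deformed_exp_eigenfunction[of h] deformed_exp_eigenfunction[of "- h"]
  by (simp add: backward_diff_eq_forward_diff_uminus)

end
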